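(* Let $X$ be an uncountable Polish space. For a linear ordering $(L,<)$ the following are equivalent: (1) $(L,<) \hookrightarrow (\mathcal{B}_1(X),<_p)$; (2) $(L,<) \hookrightarrow ([0,1]^{<\omega_1}_{\searrow 0},<_{altlex})$; (3) $(L,<) \hookrightarrow (\mathbf{\Delta}^0_2(X),\subsetneqq)$. In fact, the three posets $([0,1]^{<\omega_1}_{\searrow 0},<_{altlex})$, $(\mathbf{\Delta}^0_2(X),\subsetneqq)$ and $(\mathcal{B}_1(X),<_p)$ are pairwise embeddable into each other.
   Context: For posets $(P,<_P)$, $(Q,<_Q)$, write $P\hookrightarrow Q$ if there is a map $\Phi:P\to Q$ with $p<_P q \Rightarrow \Phi(p)<_Q\Phi(q)$ (not required to be injective). $\mathcal{B}_1(X)$ is the set of real-valued Baire class $1$ functions on $X$ (pointwise limits of continuous functions), with the pointwise order: $f<_p g$ iff $f(x)\le g(x)$ for all $x$ and $f(x)<g(x)$ for some $x$. $\mathbf{\Delta}^0_2(X)$ is the family of subsets of $X$ that are both $F_\sigma$ and $G_\delta$, ordered by proper inclusion. $[0,1]^{<\omega_1}_{\searrow 0}$ is the set of strictly decreasing transfinite sequences $(x_\alpha)_{\alpha\le\xi}$ ($\xi<\omega_1$) of reals in $[0,1]$ with last element $x_\xi=0$. Every ordinal is uniquely $\gamma+n$ with $\gamma$ a limit ordinal or $0$ and $n<\omega$; its parity is that of $n$. For distinct $\bar x=(x_\alpha)_{\alpha\le\xi}$, $\bar x'=(x'_\alpha)_{\alpha\le\xi'}$ in $[0,1]^{<\omega_1}_{\searrow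 0}$ let $\delta$ be the minimal ordinal with $x_\delta\ne x'_\delta$; then $\bar x<_{altlex}\bar x'$ iff ($\delta$ even and $x_\delta<x'_\delta$) or ($\delta$ odd and $x_\delta>x'_\delta$). *)

theory Defs
  imports "HOL-Analysis.Analysis" "HOL-Library.Countable_Set_Type"
begin

text \<open>
  A poset is a carrier with a strict order on it.  Embeddings preserve the strict order but
  need not be injective.
\<close>

definition poset_embeds :: "'a set \<Rightarrow> ('a \<Rightarrow> 'a \<Rightarrow> bool) \<Rightarrow> 'b set \<Rightarrow> ('b \<Rightarrow> 'b \<Rightarrow> bool) \<Rightarrow> bool" where
  "poset_embeds P lessP Q lessQ \<longleftrightarrow> (\<exists>\<Phi>. \<Phi> ` P \<subseteq> Q \<and> monotone_on P lessP lessQ \<Phi>)"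

definition strict_linear_ordering :: "'a set \<Rightarrow> ('a \<Rightarrow> 'a \<Rightarrow> bool) \<Rightarrow> bool" where
  "strict_linear_ordering L R \<longleftrightarrow> irreflp_on L R \<and> transp_on L R \<and> totalp_on L R"

definition Polish_space :: "'a topology \<Rightarrow> bool" where
  "Polish_space X \<longleftrightarrow> completely_metrizable_space X \<and> separable_space X"

text \<open>
  The type of \<open>X\<close> may have points outside \<open>topspace X\<close>; extensionality makes the elements of
  \<open>baire_one X\<close> correspond one-to-one to functions on \<open>topspace X\<close>.
\<close>

definition baire_one :: "'a topology \<Rightarrow> ('a \<Rightarrow> real) set" where
  "baire_one X = {f \<in> extensional (topspace X).
     \<exists>F. (\<forall>n::nat. continuous_map X euclideanreal (F n)) \<and>
         (\<forall>x \<in> topspace X. (\<lambda>n. F n x) \<longlonglongrightarrow> f x)}"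

definition pointwise_less :: "'a topology \<Rightarrow> ('a \<Rightarrow> real) \<Rightarrow> ('a \<Rightarrow> real) \<Rightarrow> bool" where
  "pointwise_less X f g \<longleftrightarrow>
     (\<forall>x \<in> topspace X. f x \<le> g x) \<and> (\<exists>x \<in> topspace X. f x < g x)"

definition Delta02 :: "'a topology \<Rightarrow> 'a set set" where
  "Delta02 X = {A. fsigma_in X A \<and> gdelta_in X A}"

text \<open>
  The countable ordinals: the elements of \<open>cardSuc natLeq\<close>, which is a well-order of type
  \<open>\<omega>\<^sub>1\<close> (see \<open>uncountable_omega1\<close> and \<open>countable_initial_segment_omega1\<close> below).
\<close>

typedef omega1 = "Field (cardSuc natLeq)"
  using Field_cardSuc_not_empty[OF natLeq_Card_order] by blast

setup_lifting type_definition_omega1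

lemma Well_order_omega1: "Well_order (cardSuc natLeq)"
  by (rule cardSuc_Well_order[OF natLeq_Card_order])

instantiation omega1 :: wellorder
begin

lift_definition less_eq_omega1 :: "omega1 \<Rightarrow> omega1 \<Rightarrow> bool"
  is "\<lambda>\<alpha> \<beta>. (\<alpha>, \<beta>) \<in> cardSuc natLeq" .

definition less_omega1 :: "omega1 \<Rightarrow> omega1 \<Rightarrow> bool" where
  "less_omega1 \<alpha> \<beta> \<longleftrightarrow> \<alpha> \<le> \<beta> \<and> \<not> \<beta> \<le> \<alpha>"

instance
proof
  note wo = Well_order_omega1[unfolded well_order_on_def linear_order_on_def
      partial_order_on_def preorder_on_def]
  fix x y z :: omega1
  show "x < y \<longleftrightarrow> x \<le> y \<and> \<not> y \<le> x" by (rule less_omega1_def)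
  show "x \<le> x"
    by transfer (use wo in \<open>auto simp: refl_on_def\<close>)
  show "x \<le> z" if "x \<le> y" "y \<le> z"
    using that by transfer (use wo in \<open>auto elim: transE\<close>)
  have antisym: "a = b" if "a \<le> b" "b \<le> a" for a b :: omega1
    using that by transfer (use wo in \<open>auto dest: antisymD\<close>)
  then show "x = y" if "x \<le> y" "y \<le> x" using that .
  have linear: "a \<le> b \<or> b \<le> a" for a b :: omega1
    by transfer (use wo in \<open>metis refl_on_def total_on_def\<close>)
  then show "x \<le> y \<or> y \<le> x" .
  fix P :: "omega1 \<Rightarrow> bool" and a :: omega1
  assume step: "\<And>x. (\<And>y. y < x \<Longrightarrow> P y) \<Longrightarrow> P x"
  have "wf {(x::omega1, y). x < y}"
  proof (rule wf_subset)
    show "wf (inv_image (cardSuc natLeq - Id) Rep_omega1)"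
      using wo by (intro wf_inv_image) auto
    show "{(x, y). x < y} \<subseteq> inv_image (cardSuc natLeq - Id) Rep_omega1"
      by (auto simp: less_omega1_def less_eq_omega1.rep_eq Rep_omega1_inject)
  qed
  then show "P a"
    by (rule wf_induct_rule) (use step in auto)
qed

end

definition osuc :: "omega1 \<Rightarrow> omega1" where
  "osuc \<alpha> = (LEAST \<beta>. \<alpha> < \<beta>)"

definition limit_or_zero :: "omega1 \<Rightarrow> bool" where
  "limit_or_zero \<gamma> \<longleftrightarrow> \<gamma> \<notin> range osuc"

text \<open>\<open>(osuc ^^ n) \<gamma>\<close> is the ordinal \<open>\<gamma> + n\<close>.\<close>

definition even_ord :: "omega1 \<Rightarrow> bool" where
  "even_ord \<alpha> \<longleftrightarrow> (\<exists>\<gamma> n. limit_or_zero \<gamma> \<and> \<alpha> = (osuc ^^ n) \<gamma> \<and> even n)"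

definition odd_ord :: "omega1 \<Rightarrow> bool" where
  "odd_ord \<alpha> \<longleftrightarrow> (\<exists>\<gamma> n. limit_or_zero \<gamma> \<and> \<alpha> = (osuc ^^ n) \<gamma> \<and> odd n)"

text \<open>
  A sequence \<open>(x\<^sub>\<alpha>)\<^bsub>\<alpha> \<le> \<xi>\<^esub>\<close> is a partial map with domain \<open>{..\<xi>}\<close>.
\<close>

definition decr_seqs :: "(omega1 \<rightharpoonup> real) set" where
  "decr_seqs = {x. \<exists>\<xi>. dom x = {..\<xi>} \<and> ran x \<subseteq> {0..1} \<and>
     (\<forall>\<alpha> \<beta>. \<alpha> < \<beta> \<and> \<beta> \<le> \<xi> \<longrightarrow> the (x \<beta>) < the (x \<alpha>)) \<and> x \<xi> = Some 0}"

text \<open>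
  For distinct elements of \<open>decr_seqs\<close> the least \<open>\<delta>\<close> with \<open>x \<delta> \<noteq> y \<delta>\<close> lies in both domains
  (lemma \<open>decr_seqs_first_difference\<close> below), so \<open>the\<close> is only applied to defined values.
\<close>

definition altlex_less :: "(omega1 \<rightharpoonup> real) \<Rightarrow> (omega1 \<rightharpoonup> real) \<Rightarrow> bool" where
  "altlex_less x y \<longleftrightarrow> x \<noteq> y \<and>
     (let \<delta> = (LEAST \<delta>. x \<delta> \<noteq> y \<delta>) in
        (even_ord \<delta> \<and> the (x \<delta>) < the (y \<delta>)) \<or>
        (odd_ord \<delta> \<and> the (x \<delta>) > the (y \<delta>)))"

lemma uncountable_omega1:
  includes cardinal_syntax
  shows "uncountable (UNIV :: omega1 set)"
proof
  assume "countable (UNIV :: omega1 set)"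
  then have "countable (Rep_omega1 ` UNIV)" by blast
  then have "countable (Field (cardSuc natLeq))"
    using type_definition.Rep_range[OF type_definition_omega1] by simp
  then have "|Field (cardSuc natLeq)| \<le>o natLeq"
    by (simp add: countable_card_le_natLeq)
  moreover have "|Field (cardSuc natLeq)| =o cardSuc natLeq"
    by (rule card_of_Field_ordIso[OF cardSuc_Card_order[OF natLeq_Card_order]])
  ultimately have "cardSuc natLeq \<le>o natLeq"
    using ordIso_symmetric ordIso_ordLeq_trans by blast
  then show False
    using cardSuc_greater[OF natLeq_Card_order] not_ordLess_ordLeq by blast
qed

lemma countable_initial_segment_omega1:
  includes cardinal_syntax
  shows "countable {..\<alpha>::omega1}"
proof -
  let ?r = "cardSuc natLeq"
  have co: "Card_order ?r"
    by (rule cardSuc_Card_order[OF natLeq_Card_order])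
  have sub: "Rep_omega1 ` {..<\<alpha>} \<subseteq> underS ?r (Rep_omega1 \<alpha>)"
    by (auto simp: underS_def less_omega1_def less_eq_omega1.rep_eq Rep_omega1_inject)
  have "|underS ?r (Rep_omega1 \<alpha>)| <o ?r"
    using card_of_underS[OF co Rep_omega1] .
  then have "|underS ?r (Rep_omega1 \<alpha>)| \<le>o natLeq"
    using cardSuc_ordLeq_ordLess[OF natLeq_Card_order card_of_Card_order] by blast
  then have "countable (underS ?r (Rep_omega1 \<alpha>))"
    by (simp add: countable_card_le_natLeq)
  then have "countable (Rep_omega1 ` {..<\<alpha>})"
    using sub countable_subset by blast
  then have "countable {..<\<alpha>}"
    by (rule countable_image_inj_on) (simp add: inj_on_def Rep_omega1_inject)
  moreover have "{..\<alpha>} = insert \<alpha> {..<\<alpha>}" by auto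
  ultimately show ?thesis by simp
qed

lemma less_osuc: "\<alpha> < osuc \<alpha>"
proof -
  have "{..\<alpha>} \<noteq> UNIV"
    using countable_initial_segment_omega1 uncountable_omega1 by metis
  then have "\<exists>\<beta>. \<alpha> < \<beta>" by (auto simp: not_le)
  then show ?thesis
    unfolding osuc_def by (rule LeastI_ex)
qed

lemma osuc_le_iff: "osuc \<alpha> \<le> \<beta> \<longleftrightarrow> \<alpha> < \<beta>"
  using less_osuc[of \<alpha>] Least_le[of "\<lambda>\<beta>. \<alpha> < \<beta>" \<beta>] unfolding osuc_def by auto

lemma osuc_inject: "osuc \<alpha> = osuc \<beta> \<longleftrightarrow> \<alpha> = \<beta>"
  by (metis less_osuc osuc_le_iff linorder_neq_iff not_le)

lemma ordinal_decomposition: "\<exists>!(\<gamma>, n). limit_or_zero \<gamma> \<and> \<alpha> = (osuc ^^ n) \<gamma>"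
proof -
  have ex: "\<exists>\<gamma> n. limit_or_zero \<gamma> \<and> \<alpha> = (osuc ^^ n) \<gamma>"
  proof (induction \<alpha> rule: less_induct)
    case (less \<alpha>)
    show ?case
    proof (cases "limit_or_zero \<alpha>")
      case True
      then show ?thesis by (intro exI[of _ \<alpha>] exI[of _ 0]) simp
    next
      case False
      then obtain \<beta> where \<beta>: "\<alpha> = osuc \<beta>" by (auto simp: limit_or_zero_def)
      then obtain \<gamma> n where "limit_or_zero \<gamma>" "\<beta> = (osuc ^^ n) \<gamma>"
        using less[of \<beta>] less_osuc by blast
      then show ?thesis using \<beta> by (intro exI[of _ \<gamma>] exI[of _ "Suc n"]) simp
    qed
  qed
  have uniq: "\<gamma> = \<gamma>' \<and> n = n'"
    if "limit_or_zero \<gamma>" "limit_or_zero \<gamma>'" "(osuc ^^ n) \<gamma> = (osuc ^^ n') \<gamma>'" for \<gamma> \<gamma>' n n'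
    using that(3)
  proof (induction n arbitrary: n')
    case 0
    then show ?case using that(1) by (cases n') (auto simp: limit_or_zero_def)
  next
    case (Suc n)
    then show ?case
      using that(2) by (cases n') (auto simp: limit_or_zero_def osuc_inject)
  qed
  show ?thesis
    using ex uniq by (auto simp: Ex1_def split_paired_Ex) metis
qed

lemma odd_ord_iff_not_even_ord: "odd_ord \<alpha> \<longleftrightarrow> \<not> even_ord \<alpha>"
proof -
  obtain \<gamma> n where ex: "limit_or_zero \<gamma>" "\<alpha> = (osuc ^^ n) \<gamma>"
    and uniq: "\<And>\<gamma>' n'. limit_or_zero \<gamma>' \<Longrightarrow> \<alpha> = (osuc ^^ n') \<gamma>' \<Longrightarrow> n' = n"
    using ordinal_decomposition[of \<alpha>] by (elim ex1E) blast
  have "even_ord \<alpha> \<longleftrightarrow> even n" "odd_ord \<alpha> \<longleftrightarrow> odd n"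
    unfolding even_ord_def odd_ord_def using ex uniq by blast+
  then show ?thesis by simp
qed

lemma decr_seqs_first_difference:
  assumes x: "x \<in> decr_seqs" and y: "y \<in> decr_seqs" and "x \<noteq> y"
  defines "\<delta> \<equiv> LEAST \<delta>. x \<delta> \<noteq> y \<delta>"
  shows "\<delta> \<in> dom x \<inter> dom y" "the (x \<delta>) \<noteq> the (y \<delta>)"
proof -
  have ne: "x \<delta> \<noteq> y \<delta>"
    unfolding \<delta>_def by (rule LeastI_ex) (use \<open>x \<noteq> y\<close> in blast)
  have eq: "x \<alpha> = y \<alpha>" if "\<alpha> < \<delta>" for \<alpha>
    using not_less_Least[OF that[unfolded \<delta>_def]] by simp
  have key: "\<delta> \<in> dom u"
    if u: "u \<in> decr_seqs" and v: "v \<in> decr_seqs" and ne: "u \<delta> \<noteq> v \<delta>"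
      and eq: "\<And>\<alpha>. \<alpha> < \<delta> \<Longrightarrow> u \<alpha> = v \<alpha>" for u v
  proof (rule ccontr)
    assume nd: "\<delta> \<notin> dom u"
    obtain \<xi> where \<xi>: "dom u = {..\<xi>}" "u \<xi> = Some 0"
      using u unfolding decr_seqs_def by blast
    obtain \<zeta> where \<zeta>: "dom v = {..\<zeta>}" "ran v \<subseteq> {0..1}"
      "\<And>\<alpha> \<beta>. \<alpha> < \<beta> \<Longrightarrow> \<beta> \<le> \<zeta> \<Longrightarrow> the (v \<beta>) < the (v \<alpha>)"
      using v unfolding decr_seqs_def by blast
    have "\<xi> < \<delta>" using nd \<xi> by auto
    then have "v \<xi> = Some 0" using eq \<xi> by auto
    moreover obtain b where b: "v \<delta> = Some b" using nd ne by (cases "v \<delta>") auto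
    moreover have "\<delta> \<le> \<zeta>" using b \<zeta>(1) by auto
    ultimately have "b < 0" using \<zeta>(3)[OF \<open>\<xi> < \<delta>\<close>] by auto
    moreover have "b \<in> ran v" using b by (rule ranI)
    ultimately show False using \<zeta>(2) by auto
  qed
  show "\<delta> \<in> dom x \<inter> dom y"
    using key[OF x y ne eq] key[OF y x ne[symmetric] eq[symmetric]] by blast
  then obtain a b where "x \<delta> = Some a" "y \<delta> = Some b" by blast
  then show "the (x \<delta>) \<noteq> the (y \<delta>)"
    using ne by simp
qed

end

theory Submission
  imports Defs
begin

text \<open>
  A sequence \<open>x\<close> colours each rational \<open>q\<close> by the parity of the least \<open>\<alpha>\<close> with \<open>x\<^sub>\<alpha> \<le> q\<close>.  An
  uncountable Polish space carries a Cantor scheme, so its points can be read as colourings of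
  the rationals.  The points that agree with the colouring of \<open>x\<close> on \<open>[x\<^sub>\<alpha>, \<infinity>)\<close> form a decreasing
  sequence of closed sets, and the points that leave it at an odd stage form a
  \<open>\<Delta>\<^sup>0\<^sub>2\<close> set that strictly increases with \<open>x\<close> in the alternating lexicographical order.

  For the way back, let \<open>f\<close> be of Baire class 1 and \<open>p < q\<close> rational.  Closing off alternately
  inside \<open>{f \<ge> q}\<close> and \<open>{f \<le> p}\<close>, which are disjoint \<open>G\<^sub>\<delta>\<close> sets, gives a decreasing sequence of closed
  sets that strictly decreases until it is empty, by Baire's theorem.  If \<open>f < g\<close>, then at the first
  place where the sequences of \<open>f\<close> and \<open>g\<close> differ for some \<open>p < q\<close>, that of \<open>f\<close> is smaller if the place
  is even and larger if it is odd; a point \<open>x\<close> with \<open>f x \<le> p\<close> and \<open>q \<le> g x\<close> shows that such a place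
  exists.  A countable base turns families of closed sets into reals.
\<close>

section \<open>Composition of embeddings and parity of successors\<close>

lemma poset_embeds_trans:
  assumes "poset_embeds P lessP Q lessQ" "poset_embeds Q lessQ R lessR"
  shows "poset_embeds P lessP R lessR"
proof -
  obtain \<Phi> \<Psi> where "\<Phi> ` P \<subseteq> Q" "monotone_on P lessP lessQ \<Phi>"
    and "\<Psi> ` Q \<subseteq> R" "monotone_on Q lessQ lessR \<Psi>"
    using assms unfolding poset_embeds_def by blast
  then have "(\<Psi> \<circ> \<Phi>) ` P \<subseteq> R \<and> monotone_on P lessP lessR (\<Psi> \<circ> \<Phi>)"
    by (auto simp: monotone_on_def image_subset_iff)
  then show ?thesis
    unfolding poset_embeds_def by blast
qed

lemma even_ord_osuc: "even_ord (osuc \<alpha>) \<longleftrightarrow> \<not> even_ord \<alpha>"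
proof -
  obtain \<gamma> n where \<gamma>: "limit_or_zero \<gamma>" "\<alpha> = (osuc ^^ n) \<gamma>"
    using ordinal_decomposition[of \<alpha>] by auto
  then have suc: "osuc \<alpha> = (osuc ^^ Suc n) \<gamma>"
    by simp
  show ?thesis
  proof (cases "even n")
    case True
    then have "even_ord \<alpha>" "odd_ord (osuc \<alpha>)"
      unfolding even_ord_def odd_ord_def using \<gamma> suc even_Suc by blast+
    then show ?thesis by (simp add: odd_ord_iff_not_even_ord)
  next
    case False
    then have "odd_ord \<alpha>" "even_ord (osuc \<alpha>)"
      unfolding even_ord_def odd_ord_def using \<gamma> suc even_Suc by blast+
    then show ?thesis by (simp add: odd_ord_iff_not_even_ord)
  qed
qed

lemma less_osuc_iff: "\<alpha> < osuc \<beta> \<longleftrightarrow> \<alpha> \<le> \<beta>"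
  using osuc_le_iff by (metis not_le)

section \<open>Indicator functions\<close>

text \<open>Both \<open>A\<close> and its complement are increasing countable unions of closed sets.
  Urysohn functions that are 1 on the n-th set of the first union and 0 on the n-th set of the
  second are eventually constant at every point.\<close>

lemma indicator_baire_one:
  assumes X: "normal_space X" and A: "A \<in> Delta02 X"
  shows "restrict (indicator A) (topspace X) \<in> baire_one X"
proof -
  have "fsigma_in X A" "fsigma_in X (topspace X - A)"
    using A by (simp_all add: Delta02_def gdelta_in_fsigma_in)
  then obtain C D where C: "\<And>n::nat. closedin X (C n)" "incseq C" "\<Union> (range C) = A"
    and D: "\<And>n::nat. closedin X (D n)" "incseq D" "\<Union> (range D) = topspace X - A"
    unfolding fsigma_in_ascending by (metis incseq_SucI)
  have "\<exists>h. continuous_map X euclideanreal h \<and> h ` C n \<subseteq> {1} \<and> h ` D n \<subseteq> {0}" for n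
  proof -
    have "disjnt (C n) (D n)"
      using C(3) D(3) unfolding disjnt_def by blast
    then show ?thesis
      using Urysohn_lemma_alt[OF X C(1) D(1)] by metis
  qed
  then obtain h where h: "\<And>n. continuous_map X euclideanreal (h n)"
    "\<And>n. h n ` C n \<subseteq> {1}" "\<And>n. h n ` D n \<subseteq> {0}"
    by metis
  have "(\<lambda>n. h n x) \<longlonglongrightarrow> indicator A x" if x: "x \<in> topspace X" for x
  proof -
    have "\<exists>N. \<forall>n\<ge>N. h n x = indicator A x"
    proof (cases "x \<in> A")
      case True
      then obtain N where "x \<in> C N" using C(3) by blast
      then have "x \<in> C n" if "n \<ge> N" for n
        using C(2) that unfolding incseq_def by blast
      then show ?thesis
        using h(2) True by (intro exI[of _ N]) auto
    next
      case False
      then obtain N where "x \<in> D N" using D(3) x by blast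
      then have "x \<in> D n" if "n \<ge> N" for n
        using D(2) that unfolding incseq_def by blast
      then show ?thesis
        using h(3) False by (intro exI[of _ N]) auto
    qed
    then show ?thesis
      by (intro tendsto_eventually) (simp add: eventually_sequentially)
  qed
  then show ?thesis
    unfolding baire_one_def using h(1) by auto
qed

lemma Delta02_embeds_baire_one:
  assumes "normal_space X"
  shows "poset_embeds (Delta02 X) (\<subset>) (baire_one X) (pointwise_less X)"
proof -
  have "pointwise_less X (restrict (indicator A) (topspace X)) (restrict (indicator B) (topspace X))"
    if "B \<in> Delta02 X" "A \<subset> B" for A B
  proof -
    have "B \<subseteq> topspace X"
      using that by (auto simp: Delta02_def dest: gdelta_in_subset)
    then show ?thesis
      using that(2) by (fastforce simp: pointwise_less_def indicator_def)
  qed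
  then show ?thesis
    unfolding poset_embeds_def
    by (intro exI[of _ "\<lambda>A. restrict (indicator A) (topspace X)"])
       (auto simp: monotone_on_def intro: indicator_baire_one[OF assms])
qed

section \<open>Cantor schemes\<close>

lemma separable_metrizable_imp_second_countable:
  assumes "metrizable_space X" "separable_space X"
  shows "second_countable X"
proof -
  obtain M d where "Metric_space M d" and X: "X = Metric_space.mtopology M d"
    using assms(1) metrizable_space_def by blast
  then interpret Metric_space M d by blast
  obtain C where C: "countable C" "C \<subseteq> M" "mtopology closure_of C = M"
    using assms(2) unfolding separable_space_def X by auto
  define \<B> where "\<B> = (\<lambda>(c, n). mball c (inverse (Suc n))) ` (C \<times> (UNIV :: nat set))"
  have "\<exists>V\<in>\<B>. x \<in> V \<and> V \<subseteq> U" if U: "openin mtopology U" "x \<in> U" for U x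
  proof -
    obtain r where r: "r > 0" "mball x r \<subseteq> U" and "x \<in> M"
      using U unfolding openin_mtopology by blast
    obtain n where n: "inverse (Suc n) < r / 2"
      using reals_Archimedean[of "r / 2"] r by auto
    have "x \<in> mtopology closure_of C" "inverse (real (Suc n)) > 0"
      using \<open>x \<in> M\<close> C(3) by simp_all
    then obtain c where "c \<in> C" "c \<in> mball x (inverse (Suc n))"
      unfolding metric_closure_of by blast
    then have c: "c \<in> C" "d x c < inverse (Suc n)"
      by simp_all
    have "mball c (inverse (Suc n)) \<subseteq> mball x r"
    proof
      fix y assume "y \<in> mball c (inverse (Suc n))"
      then have "y \<in> M" "d c y < inverse (Suc n)" "c \<in> M" by auto
      then have "d x y < r"
        using triangle[of x c y] \<open>x \<in> M\<close> c n by linarith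
      then show "y \<in> mball x r" using \<open>x \<in> M\<close> \<open>y \<in> M\<close> by simp
    qed
    moreover have "x \<in> mball c (inverse (Suc n))"
      using c \<open>x \<in> M\<close> C(2) by (auto simp: commute)
    ultimately show ?thesis
      using r c unfolding \<B>_def by (intro bexI[of _ "mball c (inverse (Suc n))"]) auto
  qed
  moreover have "countable \<B>"
    unfolding \<B>_def using C(1) by simp
  ultimately show ?thesis
    unfolding second_countable_def X by (intro exI[of _ \<B>]) (auto simp: \<B>_def)
qed

lemma second_countable_sequence:
  assumes "second_countable X"
  obtains U :: "nat \<Rightarrow> 'a set" where "\<And>i. openin X (U i)"
    "\<And>V x. openin X V \<Longrightarrow> x \<in> V \<Longrightarrow> \<exists>i. x \<in> U i \<and> U i \<subseteq> V"
proof -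
  obtain \<B> where \<B>: "countable \<B>" "\<And>V. V \<in> \<B> \<Longrightarrow> openin X V"
    "\<And>V x. openin X V \<and> x \<in> V \<longrightarrow> (\<exists>B\<in>\<B>. x \<in> B \<and> B \<subseteq> V)"
    using assms by (auto simp: second_countable_def)
  \<comment> \<open>Adding the empty set makes the family nonempty, so that it is the range of its
    enumeration.\<close>
  define U where "U = from_nat_into (insert {} \<B>)"
  have U: "range U = insert {} \<B>"
    unfolding U_def using \<B>(1) by simp
  show ?thesis
  proof
    show "openin X (U i)" for i
      using \<B>(2) U by (metis insert_iff openin_empty rangeI)
    show "\<exists>i. x \<in> U i \<and> U i \<subseteq> V" if V: "openin X V" "x \<in> V" for V x
    proof -
      obtain B where "B \<in> \<B>" "x \<in> B" "B \<subseteq> V"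
        using \<B>(3)[of V x] V by blast
      moreover then obtain i where "B = U i"
        using U by (metis insertCI rangeE)
      ultimately show ?thesis by blast
    qed
  qed
qed

text \<open>All but countably many points of \<open>C\<close> are condensation points of
  \<open>C\<close>. Small disjoint closed balls around two of them cut out \<open>D\<close> and
  \<open>E\<close>.\<close>

lemma (in Metric_space) split_uncountable_closed:
  assumes sc: "second_countable mtopology" and C: "closedin mtopology C" "uncountable C"
    and "\<epsilon> > 0"
  obtains D E where "closedin mtopology D" "closedin mtopology E" "uncountable D" "uncountable E"
    "D \<subseteq> C" "E \<subseteq> C" "D \<inter> E = {}" "\<exists>a. D \<subseteq> mcball a \<epsilon>" "\<exists>a. E \<subseteq> mcball a \<epsilon>"
proof -
  obtain \<B> where \<B>: "countable \<B>" "\<And>V. V \<in> \<B> \<Longrightarrow> openin mtopology V"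
    "\<And>V x. openin mtopology V \<and> x \<in> V \<longrightarrow> (\<exists>B\<in>\<B>. x \<in> B \<and> B \<subseteq> V)"
    using sc by (auto simp: second_countable_def)
  \<comment> \<open>\<open>K\<close> collects the points of \<open>C\<close> that are not
    condensation points.\<close>
  define K where "K = (\<Union>V\<in>{V \<in> \<B>. countable (V \<inter> C)}. V \<inter> C)"
  have "countable K"
    unfolding K_def using \<B>(1) by (intro countable_UN) auto
  then have "uncountable (C - K)"
    using C(2) by (rule uncountable_minus_countable[rotated])
  then obtain x where x: "x \<in> C - K"
    by (metis countable_empty ex_in_conv)
  then have "C - K \<noteq> {x}"
    using \<open>uncountable (C - K)\<close> by (metis countable_empty countable_insert)
  then obtain y where y: "y \<in> C - K" "y \<noteq> x"
    using x by blast
  have M: "x \<in> M" "y \<in> M"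
    using x y closedin_subset[OF C(1)] by auto
  define r where "r = min \<epsilon> (d x y / 3)"
  have "r > 0"
    unfolding r_def using M y \<open>\<epsilon> > 0\<close> by (auto simp: mdist_pos_less)
  have unc: "uncountable (mcball z r \<inter> C)" if z: "z \<in> C - K" "z \<in> M" for z
  proof
    assume c: "countable (mcball z r \<inter> C)"
    obtain V where V: "V \<in> \<B>" "z \<in> V" "V \<subseteq> mball z r"
      using \<B>(3)[of "mball z r" z] z \<open>r > 0\<close> by auto
    then have "V \<inter> C \<subseteq> mcball z r \<inter> C" by auto
    then have "countable (V \<inter> C)"
      using c by (rule countable_subset)
    then show False
      using z V unfolding K_def by blast
  qed
  have "mcball x r \<inter> C \<inter> (mcball y r \<inter> C) = {}"
  proof -
    have False if "z \<in> mcball x r" "z \<in> mcball y r" for z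
    proof -
      have "d x y \<le> r + r"
        using that triangle[of x z y] by (auto simp: commute)
      moreover have "r \<le> d x y / 3" unfolding r_def by simp
      ultimately show False using \<open>r > 0\<close> by linarith
    qed
    then show ?thesis by blast
  qed
  moreover have "mcball z r \<subseteq> mcball z \<epsilon>" for z
    by (rule mcball_subset_concentric) (simp add: r_def)
  ultimately show ?thesis
    using unc[OF x M(1)] unc[OF y(1) M(2)] C(1)
    by (intro that[of "mcball x r \<inter> C" "mcball y r \<inter> C"]) auto
qed

text \<open>A Cantor scheme: \<open>P n\<close> and \<open>N n\<close> are the unions of the pieces on level \<open>n + 1\<close> whose
  last digit is 1 respectively 0.\<close>
lemma Polish_space_independent_closed_pairs:
  assumes "Polish_space X" "uncountable (topspace X)"
  obtains P N :: "nat \<Rightarrow> 'a set" where "\<And>n. closedin X (P n)" "\<And>n. closedin X (N n)"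
    "\<And>n. P n \<inter> N n = {}" "\<And>S. (\<Inter>n. if n \<in> S then P n else N n) \<noteq> {}"
proof -
  obtain M d where "Metric_space M d" and mc: "Metric_space.mcomplete M d"
    and X: "X = Metric_space.mtopology M d"
    using assms(1) unfolding Polish_space_def completely_metrizable_space_def by blast
  then interpret Metric_space M d by blast
  have sc: "second_countable mtopology"
    using assms(1) separable_metrizable_imp_second_countable completely_metrizable_imp_metrizable_space
    unfolding X Polish_space_def by blast
  define good where "good C \<longleftrightarrow> closedin mtopology C \<and> uncountable C" for C
  have "\<forall>C n. \<exists>D E. good C \<longrightarrow> good D \<and> good E \<and> D \<subseteq> C \<and> E \<subseteq> C \<and> D \<inter> E = {} \<and>
    (\<exists>a. D \<subseteq> mcball a (inverse (Suc n))) \<and> (\<exists>a. E \<subseteq> mcball a (inverse (Suc n)))"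
    unfolding good_def using split_uncountable_closed[OF sc]
    by (metis inverse_positive_iff_positive of_nat_0_less_iff zero_less_Suc)
  then obtain D E where DE: "\<And>C n. good C \<Longrightarrow> good (D C n) \<and> good (E C n) \<and> D C n \<subseteq> C \<and>
    E C n \<subseteq> C \<and> D C n \<inter> E C n = {} \<and> (\<exists>a. D C n \<subseteq> mcball a (inverse (Suc n))) \<and>
    (\<exists>a. E C n \<subseteq> mcball a (inverse (Suc n)))"
    by metis
  \<comment> \<open>The newest digit stands at the head of the list: \<open>b # s\<close> labels a
    child of the piece \<open>s\<close>, and \<open>length s\<close> is the level that fixes the
    radius of the child.\<close>
  define U where "U = rec_list M (\<lambda>b s C. if b then D C (length s) else E C (length s))"
  have U_simps: "U [] = M" "U (b # s) = (if b then D (U s) (length s) else E (U s) (length s))" for b s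
    by (simp_all add: U_def)
  have good: "good (U s)" for s
  proof (induction s)
    case Nil
    then show ?case using assms(2) by (simp add: U_simps good_def X)
  next
    case (Cons b s)
    then show ?case using DE by (simp add: U_simps)
  qed
  have sub: "U (b # s) \<subseteq> U s" for b s
    using DE[OF good, of s] by (simp add: U_simps)
  have small: "\<exists>a. U (b # s) \<subseteq> mcball a (inverse (Suc (length s)))" for b s
    using DE[OF good, of s "length s"] by (simp add: U_simps)
  have disj: "U s \<inter> U t = {}" if "length s = length t" "s \<noteq> t" for s t
    using that
  proof (induction s t rule: list_induct2)
    case (Cons b s c t)
    show ?case
    proof (cases "s = t")
      case True
      then show ?thesis
        using DE[OF good, of s "length s"] Cons by (auto simp: U_simps)
    next
      case False
      then show ?thesis
        using Cons.IH sub[of b s] sub[of c t] by blast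
    qed
  qed simp
  have fin: "finite {s :: bool list. length s = n}" for n
    using finite_lists_length_eq[of "UNIV :: bool set" n] by simp
  define W where "W b n = (\<Union>s\<in>{s. length s = n}. U (b # s))" for b n
  \<comment> \<open>A level has finitely many pieces, so their union stays closed.\<close>
  have closed: "closedin X (W b n)" for b n
    unfolding W_def X using fin good by (intro closedin_Union) (auto simp: good_def)
  have "W True n \<inter> W False n = {}" for n
  proof -
    have "U (True # s) \<inter> U (False # t) = {}" if "length s = n" "length t = n" for s t
      using that by (intro disj) auto
    then show ?thesis unfolding W_def by blast
  qed
  moreover have "(\<Inter>n. if n \<in> S then W True n else W False n) \<noteq> {}" for S
  proof -
    \<comment> \<open>The set \<open>S\<close> prescribes the digits of a branch; completeness gives
      a point in all of its pieces.\<close>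
    define branch where "branch = rec_nat [] (\<lambda>n s. (n \<in> S) # s)"
    have br: "branch (Suc n) = (n \<in> S) # branch n" "length (branch n) = n" for n
      by (induction n) (simp_all add: branch_def)
    have "decseq (\<lambda>n. U (branch n))"
      by (rule decseq_SucI) (simp add: br sub)
    moreover have "\<exists>n a. U (branch n) \<subseteq> mcball a \<epsilon>" if pos: "\<epsilon> > 0" for \<epsilon>
    proof -
      obtain n where n: "inverse (Suc n) < \<epsilon>"
        using reals_Archimedean[OF pos] by auto
      obtain a where "U (branch (Suc n)) \<subseteq> mcball a (inverse (Suc n))"
        using small[of "n \<in> S" "branch n"] by (auto simp: br)
      also have "\<dots> \<subseteq> mcball a \<epsilon>"
        using n by (intro mcball_subset_concentric) simp
      finally show ?thesis by blast
    qed
    moreover have "closedin mtopology (U (branch n))" "U (branch n) \<noteq> {}" for n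
      using good[of "branch n"] by (auto simp: good_def)
    ultimately have "\<Inter> (range (\<lambda>n. U (branch n))) \<noteq> {}"
      using mc[unfolded mcomplete_nest, rule_format, of "\<lambda>n. U (branch n)"] by simp
    then obtain z where "z \<in> (\<Inter>n. U (branch n))" by blast
    then have "z \<in> U (branch n)" for n by simp
    then have "z \<in> U ((n \<in> S) # branch n)" for n
      by (metis br(1))
    then have "z \<in> W (n \<in> S) n" for n
      unfolding W_def using br(2) by blast
    then have "z \<in> (\<Inter>n. if n \<in> S then W True n else W False n)"
      by (intro INT_I) (metis (full_types))
    then show ?thesis by blast
  qed
  ultimately show ?thesis
    using that[of "W True" "W False"] closed by blast
qed

section \<open>Coding decreasing sequences by ambiguous sets\<close>

lemma decr_seqsE:
  assumes "x \<in> decr_seqs"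
  obtains \<xi> where "dom x = {..\<xi>}" "x \<xi> = Some 0"
    "\<And>\<alpha> a. x \<alpha> = Some a \<Longrightarrow> 0 \<le> a"
    "\<And>\<alpha> \<beta> a b. x \<alpha> = Some a \<Longrightarrow> x \<beta> = Some b \<Longrightarrow> \<alpha> < \<beta> \<Longrightarrow> b < a"
proof -
  obtain \<xi> where \<xi>: "dom x = {..\<xi>}" "ran x \<subseteq> {0..1}"
    "\<forall>\<alpha> \<beta>. \<alpha> < \<beta> \<and> \<beta> \<le> \<xi> \<longrightarrow> the (x \<beta>) < the (x \<alpha>)" "x \<xi> = Some 0"
    using assms unfolding decr_seqs_def by blast
  show ?thesis
  proof
    show "0 \<le> a" if "x \<alpha> = Some a" for \<alpha> a
      using \<xi>(2) that by (auto simp: ran_def)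
    show "b < a" if "x \<alpha> = Some a" "x \<beta> = Some b" "\<alpha> < \<beta>" for \<alpha> \<beta> a b
    proof -
      have "\<beta> \<le> \<xi>" using \<xi>(1) that(2) by blast
      then show ?thesis using \<xi>(3) that by fastforce
    qed
  qed (use \<xi> in auto)
qed

text \<open>Membership of a point in \<open>P n\<close> or \<open>N n\<close> is read as one of two
  colours of \<open>q n\<close>. Disjointness keeps a point from carrying both colours, and
  independence provides a point for every colouring.\<close>

locale closed_pair_coding =
  fixes X :: "'a topology" and P N :: "nat \<Rightarrow> 'a set" and q :: "nat \<Rightarrow> real"
  assumes metrizable: "metrizable_space X"
    and closed: "closedin X (P n)" "closedin X (N n)"
    and disjoint: "P n \<inter> N n = {}"
    and independent: "(\<Inter>n. if n \<in> S then P n else N n) \<noteq> {}"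
    and dense: "a < b \<Longrightarrow> \<exists>n. a < q n \<and> q n < b"
begin

text \<open>If no entry is at most \<open>q n\<close>, the \<open>LEAST\<close> has no meaning;
  \<open>block\<close> asks for the colour only when there is such an entry.\<close>

definition colour :: "(omega1 \<rightharpoonup> real) \<Rightarrow> nat \<Rightarrow> bool" where
  "colour x n \<longleftrightarrow> even_ord (LEAST \<alpha>. \<exists>a. x \<alpha> = Some a \<and> a \<le> q n)"

text \<open>An undefined entry gives the empty set, so that every point has left by
  \<open>osuc \<xi>\<close>, where \<xi> is the last index.\<close>

definition block :: "(omega1 \<rightharpoonup> real) \<Rightarrow> omega1 \<Rightarrow> 'a set" where
  "block x \<alpha> = (case x \<alpha> of None \<Rightarrow> {} | Some a \<Rightarrow>
     {z \<in> topspace X. \<forall>n. a \<le> q n \<longrightarrow> z \<in> (if colour x n then P n else N n)})"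

definition exit_index :: "(omega1 \<rightharpoonup> real) \<Rightarrow> 'a \<Rightarrow> omega1" where
  "exit_index x z = (LEAST \<alpha>. z \<notin> block x \<alpha>)"

definition code_set :: "(omega1 \<rightharpoonup> real) \<Rightarrow> 'a set" where
  "code_set x = {z \<in> topspace X. \<not> even_ord (exit_index x z)}"

lemma closedin_block: "closedin X (block x \<alpha>)"
proof (cases "x \<alpha>")
  case (Some a)
  have "block x \<alpha> = (\<Inter>n. if a \<le> q n then (if colour x n then P n else N n) else topspace X) \<inter> topspace X"
    by (auto simp: block_def Some split: if_splits)
  then show ?thesis
    using closed by (auto intro!: closedin_Int closedin_Inter)
qed (simp add: block_def)

lemma block_antimono:
  assumes "x \<in> decr_seqs" "\<alpha> \<le> \<beta>"
  shows "block x \<beta> \<subseteq> block x \<alpha>"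
proof (cases "x \<beta> = None \<or> \<alpha> = \<beta>")
  case False
  then obtain b where b: "x \<beta> = Some b" by auto
  obtain \<xi> where \<xi>: "dom x = {..\<xi>}"
    "\<And>\<alpha> \<beta> a b. x \<alpha> = Some a \<Longrightarrow> x \<beta> = Some b \<Longrightarrow> \<alpha> < \<beta> \<Longrightarrow> b < a"
    using assms(1) by (rule decr_seqsE) blast
  have "\<beta> \<le> \<xi>" using b \<xi>(1) by blast
  then have "\<alpha> \<in> dom x" using assms(2) \<xi>(1) by auto
  then obtain a where a: "x \<alpha> = Some a" by blast
  then have "b < a" using \<xi>(2) b False assms(2) by (metis order_neq_le_trans)
  then show ?thesis by (auto simp: block_def a b)
qed (auto simp: block_def)

lemma exit_index:
  assumes x: "x \<in> decr_seqs" "dom x = {..\<xi>}"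
  shows "z \<notin> block x (exit_index x z)" "\<alpha> < exit_index x z \<Longrightarrow> z \<in> block x \<alpha>"
    "exit_index x z \<le> osuc \<xi>"
proof -
  have "osuc \<xi> \<notin> dom x"
    using x(2) less_osuc[of \<xi>] by auto
  then have out: "z \<notin> block x (osuc \<xi>)"
    by (auto simp: block_def split: option.splits)
  then show "z \<notin> block x (exit_index x z)" "exit_index x z \<le> osuc \<xi>"
    unfolding exit_index_def by (rule LeastI, rule Least_le)
  show "\<alpha> < exit_index x z \<Longrightarrow> z \<in> block x \<alpha>"
    unfolding exit_index_def using not_less_Least by blast
qed

lemma exit_index_eqI:
  assumes "x \<in> decr_seqs" "z \<notin> block x \<alpha>" "\<And>\<beta>. \<beta> < \<alpha> \<Longrightarrow> z \<in> block x \<beta>"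
  shows "exit_index x z = \<alpha>"
  unfolding exit_index_def
proof (rule Least_equality)
  show "\<alpha> \<le> \<beta>" if "z \<notin> block x \<beta>" for \<beta>
    using that assms(3)[of \<beta>] by (meson not_le)
qed (rule assms(2))

text \<open>Leaving at a fixed \<alpha> means lying in a closed set, the intersection of the earlier
  blocks, and in the open complement of the block at \<alpha>. Only the countably many \<alpha> up
  to \<open>osuc \<xi>\<close> occur. A general \<open>E\<close> covers \<open>code_set\<close> and
  its complement alike.\<close>

lemma fsigma_exit_index:
  assumes x: "x \<in> decr_seqs"
  shows "fsigma_in X {z \<in> topspace X. exit_index x z \<in> E}"
proof -
  obtain \<xi> where \<xi>: "dom x = {..\<xi>}" using x by (rule decr_seqsE)
  have level: "{z \<in> topspace X. exit_index x z = \<alpha>}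
      = topspace X \<inter> (\<Inter>\<beta>\<in>{..<\<alpha>}. block x \<beta>) \<inter> (topspace X - block x \<alpha>)" (is "_ = ?R \<alpha>") for \<alpha>
  proof -
    have "exit_index x z = \<alpha> \<longleftrightarrow> (\<forall>\<beta><\<alpha>. z \<in> block x \<beta>) \<and> z \<notin> block x \<alpha>" for z
      using exit_index(1,2)[OF x \<xi>, where z = z] exit_index_eqI[OF x, of z \<alpha>] by blast
    then show ?thesis by auto
  qed
  have "{z \<in> topspace X. exit_index x z \<in> E} = (\<Union>\<alpha>\<in>E \<inter> {..osuc \<xi>}. ?R \<alpha>)"
    unfolding level[symmetric] using exit_index(3)[OF x \<xi>] by auto
  moreover have "fsigma_in X (?R \<alpha>)" for \<alpha>
  proof -
    have "topspace X \<inter> (\<Inter>\<beta>\<in>{..<\<alpha>}. block x \<beta>)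
        = \<Inter> (insert (topspace X) (block x ` {..<\<alpha>}))" by simp
    then have "closedin X (topspace X \<inter> (\<Inter>\<beta>\<in>{..<\<alpha>}. block x \<beta>))"
      using closedin_block by (metis (no_types, lifting) closedin_Inter closedin_topspace imageE insertE insert_not_empty)
    moreover have "openin X (topspace X - block x \<alpha>)"
      using closedin_block by blast
    ultimately show ?thesis
      using metrizable by (intro fsigma_in_Int closed_imp_fsigma_in open_imp_fsigma_in)
  qed
  ultimately show ?thesis
    using countable_initial_segment_omega1 by (auto intro!: fsigma_in_Union)
qed

lemma code_set_Delta02:
  assumes "x \<in> decr_seqs"
  shows "code_set x \<in> Delta02 X"
proof -
  have eq: "code_set x = {z \<in> topspace X. exit_index x z \<in> {\<alpha>. \<not> even_ord \<alpha>}}"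
    "topspace X - code_set x = {z \<in> topspace X. exit_index x z \<in> {\<alpha>. even_ord \<alpha>}}"
    by (auto simp: code_set_def)
  have "fsigma_in X (code_set x)"
    unfolding eq(1) by (rule fsigma_exit_index[OF assms])
  moreover have "fsigma_in X (topspace X - code_set x)"
    unfolding eq(2) by (rule fsigma_exit_index[OF assms])
  ultimately show ?thesis
    by (simp add: Delta02_def gdelta_in_fsigma_in fsigma_in_subset)
qed

text \<open>Two sequences that first differ at \<open>\<delta>\<close>; nothing here depends on the parity of \<open>\<delta>\<close>.\<close>

context
  fixes u v :: "omega1 \<rightharpoonup> real" and \<delta> a b
  assumes u: "u \<in> decr_seqs" and v: "v \<in> decr_seqs"
    and agree: "\<And>\<alpha>. \<alpha> < \<delta> \<Longrightarrow> u \<alpha> = v \<alpha>"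
    and u\<delta>: "u \<delta> = Some a" and v\<delta>: "v \<delta> = Some b" and "a < b"
begin

lemma above_before_difference: "\<alpha> < \<delta> \<Longrightarrow> u \<alpha> = Some c \<Longrightarrow> b < c" "\<alpha> < \<delta> \<Longrightarrow> v \<alpha> = Some c \<Longrightarrow> b < c"
proof -
  show "b < c" if "\<alpha> < \<delta>" "v \<alpha> = Some c"
    using v by (rule decr_seqsE) (use that v\<delta> in blast)
  then show "b < c" if "\<alpha> < \<delta>" "u \<alpha> = Some c"
    using that agree by simp
qed

text \<open>At \<delta> both entries are at most \<open>q n\<close>, and before \<delta> the
  sequences coincide, so both searches stop at the same index.\<close>

lemma colour_agree:
  assumes "b \<le> q n"
  shows "colour u n \<longleftrightarrow> colour v n"
proof -
  let ?p = "\<lambda>x \<alpha>. \<exists>a. x \<alpha> = Some a \<and> a \<le> q n"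
  have "?p u \<delta>" "?p v \<delta>"
    using u\<delta> v\<delta> \<open>a < b\<close> assms by auto
  then have "(LEAST \<alpha>. ?p u \<alpha>) \<le> \<delta>" "(LEAST \<alpha>. ?p v \<alpha>) \<le> \<delta>"
    by (blast intro: Least_le)+
  moreover have "?p u (LEAST \<alpha>. ?p u \<alpha>)"
    using \<open>?p u \<delta>\<close> by (rule LeastI)
  moreover have "?p v (LEAST \<alpha>. ?p v \<alpha>)"
    using \<open>?p v \<delta>\<close> by (rule LeastI)
  moreover have "?p u \<alpha> \<longleftrightarrow> ?p v \<alpha>" if "\<alpha> \<le> \<delta>" for \<alpha>
    using that agree \<open>?p u \<delta>\<close> \<open>?p v \<delta>\<close> by (metis order_le_less)
  ultimately have "?p v (LEAST \<alpha>. ?p u \<alpha>)" "?p u (LEAST \<alpha>. ?p v \<alpha>)"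
    by simp_all
  then have "(LEAST \<alpha>. ?p u \<alpha>) = (LEAST \<alpha>. ?p v \<alpha>)"
    by (intro order_antisym Least_le)
  then show ?thesis by (simp add: colour_def)
qed

text \<open>All entries before \<delta> exceed \<open>b\<close>, so \<open>u\<close> first drops to
  \<open>q n\<close> at \<delta>. In \<open>colour_upper\<close>, \<open>v\<close> does so one step
  later, which gives the opposite colour.\<close>

lemma colour_lower:
  assumes "a \<le> q n" "q n < b"
  shows "colour u n \<longleftrightarrow> even_ord \<delta>"
proof -
  have "(LEAST \<alpha>. \<exists>a. u \<alpha> = Some a \<and> a \<le> q n) = \<delta>"
    using u\<delta> assms above_before_difference(1) by (intro Least_equality) (force intro: leI)+
  then show ?thesis by (simp add: colour_def)
qed

lemma colour_upper:
  assumes "v (osuc \<delta>) = Some c" "c \<le> q n" "q n < b"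
  shows "colour v n \<longleftrightarrow> \<not> even_ord \<delta>"
proof -
  have "(LEAST \<alpha>. \<exists>a. v \<alpha> = Some a \<and> a \<le> q n) = osuc \<delta>"
  proof (rule Least_equality)
    fix \<alpha> assume \<alpha>: "\<exists>a. v \<alpha> = Some a \<and> a \<le> q n"
    show "osuc \<delta> \<le> \<alpha>"
    proof (rule ccontr)
      assume "\<not> osuc \<delta> \<le> \<alpha>"
      then have "\<alpha> < \<delta> \<or> \<alpha> = \<delta>"
        by (auto simp: osuc_le_iff)
      then show False
        using \<alpha> v\<delta> above_before_difference(2) assms(3) by fastforce
    qed
  qed (use assms in blast)
  then show ?thesis by (simp add: colour_def even_ord_osuc)
qed

lemma block_agree:
  assumes "\<alpha> < \<delta>"
  shows "block u \<alpha> = block v \<alpha>"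
proof (cases "v \<alpha>")
  case (Some c)
  then have "b \<le> q n" if "c \<le> q n" for n
    using above_before_difference(2)[OF assms Some] that by simp
  then show ?thesis
    using agree[OF assms] colour_agree by (auto simp: block_def Some)
qed (simp add: block_def agree[OF assms])

lemma block_lower_subset: "block u \<delta> \<subseteq> block v \<delta>"
proof -
  have "a \<le> q n \<and> (colour u n \<longleftrightarrow> colour v n)" if "b \<le> q n" for n
    using colour_agree[OF that] \<open>a < b\<close> that by simp
  then show ?thesis
    by (auto simp: block_def u\<delta> v\<delta>)
qed

lemma block_lower_disjoint: "block u \<delta> \<inter> block v (osuc \<delta>) = {}"
proof (cases "v (osuc \<delta>)")
  case (Some c)
  have "c < b" using v by (rule decr_seqsE) (use Some v\<delta> less_osuc in blast)
  then obtain n where "max a c < q n" "q n < b"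
    using dense[of "max a c" b] \<open>a < b\<close> by auto
  then have n: "a \<le> q n" "c \<le> q n" "q n < b" by auto
  have False if "z \<in> block u \<delta>" "z \<in> block v (osuc \<delta>)" for z
  proof -
    have "z \<in> (if colour u n then P n else N n)" "z \<in> (if colour v n then P n else N n)"
      using that n by (simp_all add: block_def u\<delta> Some)
    then show False
      using n disjoint[of n] colour_lower[of n] colour_upper[OF Some, of n] by (auto split: if_splits)
  qed
  then show ?thesis by blast
qed (simp add: block_def)

text \<open>Below \<open>b\<close> and above both \<open>a\<close> and the next entry of
  \<open>v\<close>, \<open>block u \<delta>\<close> and \<open>block v (osuc \<delta>)\<close> each
  demand one constant colour. A point with different colours at two such places that follows
  \<open>v\<close> from \<open>b\<close> on avoids both blocks but stays in
  \<open>block v \<delta>\<close>.\<close>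

lemma ex_block_difference: "\<exists>z \<in> block v \<delta>. z \<notin> block u \<delta> \<and> z \<notin> block v (osuc \<delta>)"
proof -
  \<comment> \<open>The default \<open>a\<close> keeps \<open>c < b\<close> also if \<open>v\<close>
    has no entry at \<open>osuc \<delta>\<close>.\<close>
  define c where "c = (case v (osuc \<delta>) of None \<Rightarrow> a | Some c \<Rightarrow> c)"
  have "c < b"
    using v by (rule decr_seqsE) (use \<open>a < b\<close> v\<delta> less_osuc in \<open>auto simp: c_def split: option.splits\<close>)
  then obtain n where n: "max a c < q n" "q n < b"
    using dense[of "max a c" b] \<open>a < b\<close> by auto
  then obtain m where m: "q n < q m" "q m < b"
    using dense by blast
  define T where "T = {k. if b \<le> q k then colour v k else k = n}"
  obtain z where z: "\<And>k. z \<in> (if k \<in> T then P k else N k)"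
    using independent[of T] by blast
  have "z \<in> topspace X"
    using z[of 0] closed[of 0] by (auto dest: closedin_subset split: if_splits)
  have "m \<noteq> n" using m by auto
  then have "z \<in> P n" "z \<in> N m"
    using z[of n] z[of m] n m by (simp_all add: T_def)
  then have pn: "z \<notin> N n" "z \<notin> P m"
    using disjoint by blast+
  have "z \<in> block v \<delta>"
  proof -
    have "z \<in> (if colour v k then P k else N k)" if "b \<le> q k" for k
      using z[of k] that by (simp add: T_def)
    then show ?thesis
      using \<open>z \<in> topspace X\<close> by (simp add: block_def v\<delta>)
  qed
  moreover have "z \<notin> block u \<delta>"
  proof
    assume "z \<in> block u \<delta>"
    then have "z \<in> (if colour u k then P k else N k)" if "a \<le> q k" for k
      using that by (simp add: block_def u\<delta>)
    from this[of n] this[of m] show False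
      using n m pn colour_lower[of n] colour_lower[of m] by (auto split: if_splits)
  qed
  moreover have "z \<notin> block v (osuc \<delta>)"
  proof (cases "v (osuc \<delta>)")
    case (Some c')
    then have "c' = c" by (simp add: c_def)
    show ?thesis
    proof
      assume "z \<in> block v (osuc \<delta>)"
      then have "z \<in> (if colour v k then P k else N k)" if "c \<le> q k" for k
        using that by (simp add: block_def Some \<open>c' = c\<close>)
      from this[of n] this[of m] show False
        using n m pn \<open>c' = c\<close> colour_upper[OF Some, of n] colour_upper[OF Some, of m]
        by (auto split: if_splits)
    qed
  qed (simp add: block_def)
  ultimately show ?thesis by blast
qed

text \<open>A point that leaves \<open>u\<close> before \<delta> leaves \<open>v\<close> at the same
  time. One in \<open>block u \<delta>\<close> lies in \<open>block v \<delta>\<close> but not in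
  the next block of \<open>v\<close>. For even \<delta> the last two alternatives mean being outside
  \<open>code_set u\<close> or inside \<open>code_set v\<close>; for odd \<delta> the two sets
  change roles.\<close>

lemma exit_index_cases:
  "exit_index u z = exit_index v z \<or> exit_index u z = \<delta> \<or> exit_index v z = osuc \<delta>"
proof -
  obtain \<xi> where \<xi>: "dom u = {..\<xi>}" using u by (rule decr_seqsE)
  note eu = exit_index(1,2)[OF u \<xi>, where z = z]
  consider "exit_index u z < \<delta>" | "exit_index u z = \<delta>" | "\<delta> < exit_index u z"
    by (rule linorder_cases)
  then show ?thesis
  proof cases
    case 1
    have "exit_index v z = exit_index u z"
      by (rule exit_index_eqI[OF v]) (use 1 eu block_agree order_less_trans in blast)+
    then show ?thesis by simp
  next
    case 3
    then have "z \<in> block u \<delta>" using eu by blast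
    then have "z \<in> block v \<delta>" "z \<notin> block v (osuc \<delta>)"
      using block_lower_subset block_lower_disjoint by blast+
    then have "exit_index v z = osuc \<delta>"
      using block_antimono[OF v] by (intro exit_index_eqI[OF v]) (auto simp: less_osuc_iff)
    then show ?thesis by simp
  qed simp
qed

lemma ex_exit_index: "\<exists>z\<in>topspace X. exit_index u z = \<delta> \<and> exit_index v z = osuc \<delta>"
proof -
  obtain z where z: "z \<in> block v \<delta>" "z \<notin> block u \<delta>" "z \<notin> block v (osuc \<delta>)"
    using ex_block_difference by blast
  have below: "z \<in> block v \<alpha>" if "\<alpha> \<le> \<delta>" for \<alpha>
    using z(1) block_antimono[OF v that] by blast
  have "exit_index u z = \<delta>"
    using z below block_agree by (intro exit_index_eqI[OF u]) auto
  moreover have "exit_index v z = osuc \<delta>"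
    using z below by (intro exit_index_eqI[OF v]) (auto simp: less_osuc_iff)
  moreover have "z \<in> topspace X"
    using z(1) closedin_subset[OF closedin_block] by blast
  ultimately show ?thesis by blast
qed

end

lemma code_set_strict_mono:
  assumes x: "x \<in> decr_seqs" and y: "y \<in> decr_seqs" and "altlex_less x y"
  shows "code_set x \<subset> code_set y"
proof -
  define \<delta> where "\<delta> = (LEAST \<delta>. x \<delta> \<noteq> y \<delta>)"
  have "x \<noteq> y" and less: "even_ord \<delta> \<and> the (x \<delta>) < the (y \<delta>) \<or> \<not> even_ord \<delta> \<and> the (y \<delta>) < the (x \<delta>)"
    using assms(3) unfolding altlex_less_def Let_def \<delta>_def odd_ord_iff_not_even_ord by auto
  have agree: "x \<alpha> = y \<alpha>" if "\<alpha> < \<delta>" for \<alpha>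
    using not_less_Least that unfolding \<delta>_def by blast
  obtain a b where ab: "x \<delta> = Some a" "y \<delta> = Some b"
    using decr_seqs_first_difference[OF x y \<open>x \<noteq> y\<close>] unfolding \<delta>_def by blast
  show ?thesis
  proof (cases "even_ord \<delta>")
    case True
    then have "a < b" using less ab by simp
    note gap = x y agree ab \<open>a < b\<close>
    have "z \<in> code_set y" if "z \<in> code_set x" for z
      using exit_index_cases[OF gap, of z] that True by (auto simp: code_set_def even_ord_osuc)
    moreover have "\<exists>z. z \<in> code_set y \<and> z \<notin> code_set x"
      using ex_exit_index[OF gap] True by (force simp: code_set_def even_ord_osuc)
    ultimately show ?thesis by blast
  next
    case False
    then have "b < a" using less ab by simp
    \<comment> \<open>At an odd \<delta> the greater sequence has the smaller entry, so
      \<open>y\<close> takes the role of \<open>u\<close>.\<close>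
    note gap = y x agree[symmetric] ab(2,1) \<open>b < a\<close>
    have "z \<in> code_set y" if "z \<in> code_set x" for z
      using exit_index_cases[OF gap, of z] that False by (auto simp: code_set_def even_ord_osuc)
    moreover have "\<exists>z. z \<in> code_set y \<and> z \<notin> code_set x"
      using ex_exit_index[OF gap] False by (force simp: code_set_def even_ord_osuc)
    ultimately show ?thesis by blast
  qed
qed

end

lemma decr_seqs_embeds_Delta02:
  assumes "Polish_space X" "uncountable (topspace X)"
  shows "poset_embeds decr_seqs altlex_less (Delta02 X) (\<subset>)"
proof -
  obtain P N :: "nat \<Rightarrow> 'a set" where "\<And>n. closedin X (P n)" "\<And>n. closedin X (N n)"
    "\<And>n. P n \<inter> N n = {}" "\<And>S. (\<Inter>n. if n \<in> S then P n else N n) \<noteq> {}"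
    using Polish_space_independent_closed_pairs[OF assms] by metis
  moreover have "\<exists>n. a < from_nat_into \<rat> n \<and> from_nat_into \<rat> n < b" if "a < b" for a b :: real
    using Rats_dense_in_real[OF that] from_nat_into_surj[OF countable_rat] by metis
  moreover have "metrizable_space X"
    using assms(1) by (auto simp: Polish_space_def completely_metrizable_imp_metrizable_space)
  ultimately interpret closed_pair_coding X P N "from_nat_into \<rat>"
    by unfold_locales auto
  show ?thesis
    unfolding poset_embeds_def
    using code_set_Delta02 code_set_strict_mono by (intro exI[of _ code_set]) (simp add: monotone_on_def image_subset_iff)
qed

section \<open>Coding decreasing sequences of sets of naturals\<close>

text \<open>Distinct comparable sets get distinct values, in the order of inclusion; incomparable
  sets can share one, such as \<open>{0}\<close> and the set of positive naturals.\<close>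

definition binary_value :: "nat set \<Rightarrow> real" where
  "binary_value S = (\<Sum>n. if n \<in> S then (1/2) ^ Suc n else 0)"

lemma summable_binary_value: "summable (\<lambda>n. if n \<in> S then (1/2::real) ^ Suc n else 0)"
proof (rule summable_comparison_test')
  show "summable (\<lambda>n. (1/2::real) ^ Suc n)"
    using power_half_series by (rule sums_summable)
qed simp

lemma binary_value_empty: "binary_value {} = 0"
  by (simp add: binary_value_def)

lemma binary_value_bounds: "binary_value S \<in> {0..1}"
proof -
  have "binary_value S \<le> (\<Sum>n. (1/2) ^ Suc n)"
    unfolding binary_value_def
    by (rule suminf_le[OF _ summable_binary_value sums_summable[OF power_half_series]]) auto
  then show ?thesis
    using sums_unique[OF power_half_series] suminf_nonneg[OF summable_binary_value[of S]]
    by (auto simp: binary_value_def)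
qed

lemma binary_value_strict_mono:
  assumes "S \<subset> T"
  shows "binary_value S < binary_value T"
proof -
  let ?f = "\<lambda>S n. if n \<in> S then (1/2::real) ^ Suc n else 0"
  obtain k where k: "k \<in> T" "k \<notin> S" using assms by blast
  have "0 < (\<Sum>n. ?f T n - ?f S n)"
  proof (rule suminf_pos2)
    show "summable (\<lambda>n. ?f T n - ?f S n)"
      by (intro summable_diff summable_binary_value)
    show "0 \<le> ?f T n - ?f S n" for n using assms by auto
    show "0 < ?f T k - ?f S k" using k by simp
  qed
  also have "\<dots> = binary_value T - binary_value S"
    unfolding binary_value_def by (rule suminf_diff[symmetric]) (rule summable_binary_value)+
  finally show ?thesis by simp
qed

text \<open>The sequence ends with the first empty set, whose value is the required final 0.\<close>

definition decr_seq_of :: "(omega1 \<Rightarrow> nat set) \<Rightarrow> omega1 \<rightharpoonup> real" where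
  "decr_seq_of S \<alpha> = (if \<forall>\<beta><\<alpha>. S \<beta> \<noteq> {} then Some (binary_value (S \<alpha>)) else None)"

text \<open>Otherwise every step to a successor loses a natural number. The lost numbers are
  distinct, so \<open>omega1\<close> would be countable.\<close>

lemma antimono_stabilises:
  fixes S :: "omega1 \<Rightarrow> nat set"
  assumes "antimono S"
  shows "\<exists>\<alpha>. S \<alpha> = S (osuc \<alpha>)"
proof (rule ccontr)
  assume "\<nexists>\<alpha>. S \<alpha> = S (osuc \<alpha>)"
  moreover have "S (osuc \<alpha>) \<subseteq> S \<alpha>" for \<alpha>
    using assms less_osuc by (simp add: antimonoD order_less_imp_le)
  ultimately have "\<forall>\<alpha>. \<exists>n. n \<in> S \<alpha> - S (osuc \<alpha>)" by blast
  then obtain h where h: "\<And>\<alpha>. h \<alpha> \<in> S \<alpha> - S (osuc \<alpha>)" by metis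
  have "h \<alpha> \<noteq> h \<beta>" if "\<alpha> < \<beta>" for \<alpha> \<beta>
  proof -
    have "S \<beta> \<subseteq> S (osuc \<alpha>)"
      using assms that by (simp add: antimonoD osuc_le_iff)
    then show ?thesis using h by (metis DiffE subsetD)
  qed
  then have "inj h"
    by (metis injI linorder_neqE)
  then have "countable (UNIV :: omega1 set)"
    by (rule countableI)
  then show False using uncountable_omega1 by blast
qed

text \<open>Some stage is stable, hence empty; before the first empty stage no stage equals its
  successor, so the inclusions are proper.\<close>

lemma decr_seq_of_in_decr_seqs:
  assumes anti: "antimono S" and stable: "\<And>\<alpha>. S \<alpha> = S (osuc \<alpha>) \<Longrightarrow> S \<alpha> = {}"
  shows "decr_seq_of S \<in> decr_seqs"
proof -
  define \<xi> where "\<xi> = (LEAST \<alpha>. S \<alpha> = {})"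
  have "\<exists>\<alpha>. S \<alpha> = {}"
    using antimono_stabilises[OF anti] stable by blast
  then have \<xi>: "S \<xi> = {}" unfolding \<xi>_def by (rule LeastI_ex)
  have "S \<alpha> \<noteq> {}" if "\<alpha> < \<xi>" for \<alpha>
    using not_less_Least that unfolding \<xi>_def by blast
  then have alive: "(\<forall>\<beta><\<alpha>. S \<beta> \<noteq> {}) \<longleftrightarrow> \<alpha> \<le> \<xi>" for \<alpha>
    using \<xi> by (metis not_le order_less_le_trans)
  have dec: "binary_value (S \<beta>) < binary_value (S \<alpha>)" if "\<alpha> < \<beta>" "\<beta> \<le> \<xi>" for \<alpha> \<beta>
  proof (rule binary_value_strict_mono)
    have "S \<alpha> \<noteq> {}" using alive[of \<beta>] that by blast
    then have "S (osuc \<alpha>) \<noteq> S \<alpha>" using stable by metis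
    moreover have "S (osuc \<alpha>) \<subseteq> S \<alpha>" "S \<beta> \<subseteq> S (osuc \<alpha>)"
      using anti that less_osuc by (simp_all add: antimonoD order_less_imp_le osuc_le_iff)
    ultimately show "S \<beta> \<subset> S \<alpha>" by blast
  qed
  have "dom (decr_seq_of S) = {..\<xi>}" "decr_seq_of S \<xi> = Some 0"
    by (auto simp: decr_seq_of_def dom_def alive \<xi> binary_value_empty)
  moreover have "ran (decr_seq_of S) \<subseteq> {0..1}"
    using binary_value_bounds by (auto simp: ran_def decr_seq_of_def split: if_splits)
  moreover have "the (decr_seq_of S \<beta>) < the (decr_seq_of S \<alpha>)" if "\<alpha> < \<beta>" "\<beta> \<le> \<xi>" for \<alpha> \<beta>
    using dec[OF that] that by (simp add: decr_seq_of_def alive order_less_imp_le)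
  ultimately show ?thesis
    unfolding decr_seqs_def by blast
qed

lemma altlex_less_decr_seq_of:
  assumes anti: "antimono S" "antimono T"
    and agree: "\<And>\<alpha>. \<alpha> < \<delta> \<Longrightarrow> S \<alpha> = T \<alpha>"
    and less: "if even_ord \<delta> then S \<delta> \<subset> T \<delta> else T \<delta> \<subset> S \<delta>"
  shows "altlex_less (decr_seq_of S) (decr_seq_of T)"
proof -
  \<comment> \<open>An empty stage before \<delta> would make both sets at \<delta> empty, against
    the proper inclusion; so both sequences are defined at \<delta>.\<close>
  have alive: "S \<beta> \<noteq> {}" if "\<beta> < \<delta>" for \<beta>
  proof
    assume "S \<beta> = {}"
    then have "S \<delta> = {}" "T \<delta> = {}"
      using agree[OF that] that anti by (metis antimonoD order_less_imp_le subset_empty)+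
    then show False using less by (simp split: if_splits)
  qed
  then have val: "decr_seq_of S \<delta> = Some (binary_value (S \<delta>))" "decr_seq_of T \<delta> = Some (binary_value (T \<delta>))"
    using agree by (auto simp: decr_seq_of_def)
  have cmp: "if even_ord \<delta> then binary_value (S \<delta>) < binary_value (T \<delta>)
      else binary_value (T \<delta>) < binary_value (S \<delta>)"
    using less binary_value_strict_mono by simp
  have "decr_seq_of S \<alpha> = decr_seq_of T \<alpha>" if "\<alpha> < \<delta>" for \<alpha>
    using agree that by (auto simp: decr_seq_of_def)
  then have "(LEAST \<alpha>. decr_seq_of S \<alpha> \<noteq> decr_seq_of T \<alpha>) = \<delta>"
    using val cmp by (intro Least_equality) (force intro: leI split: if_splits)+
  moreover have "decr_seq_of S \<noteq> decr_seq_of T"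
    using val cmp by (auto split: if_splits)
  ultimately show ?thesis
    using val cmp by (auto simp: altlex_less_def odd_ord_iff_not_even_ord split: if_splits)
qed

section \<open>Alternating closures\<close>

text \<open>At the least ordinal, which is even, the second condition is void and the value is the
  closure of \<open>A\<close>. Limits are even as well, so they close off points of \<open>A\<close>
  that lie in all earlier stages.\<close>

function alt_closure :: "'a topology \<Rightarrow> 'a set \<Rightarrow> 'a set \<Rightarrow> omega1 \<Rightarrow> 'a set" where
  "alt_closure X A B \<alpha> =
     X closure_of ((if even_ord \<alpha> then A else B) \<inter> {x. \<forall>\<beta>\<in>{..<\<alpha>}. x \<in> alt_closure X A B \<beta>})"
  by auto
termination
proof (relation "inv_image {(\<alpha>, \<beta>). \<alpha> < \<beta>} (\<lambda>(X, A, B, \<alpha>). \<alpha>)")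
  show "wf (inv_image {(\<alpha>, \<beta>). \<alpha> < \<beta>} (\<lambda>(X, A, B, \<alpha>::omega1). \<alpha>))"
    by (intro wf_inv_image wf)
qed auto

declare alt_closure.simps [simp del]

lemma closedin_alt_closure: "closedin X (alt_closure X A B \<alpha>)"
  unfolding alt_closure.simps[of X A B \<alpha>] by (rule closedin_closure_of)

lemma alt_closure_antimono: "antimono (alt_closure X A B)"
proof
  fix \<alpha> \<beta> :: omega1
  assume "\<alpha> \<le> \<beta>"
  show "alt_closure X A B \<beta> \<subseteq> alt_closure X A B \<alpha>"
  proof (cases "\<alpha> = \<beta>")
    case False
    then have "\<alpha> < \<beta>" using \<open>\<alpha> \<le> \<beta>\<close> by simp
    show ?thesis
      unfolding alt_closure.simps[of X A B \<beta>] using \<open>\<alpha> < \<beta>\<close>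
      by (intro closure_of_minimal[OF _ closedin_alt_closure]) auto
  qed simp
qed

text \<open>The set whose closure is taken lies in its own closure. This supplies the density for
  Baire's theorem below.\<close>

lemma alt_closure_dense:
  assumes "A \<subseteq> topspace X" "B \<subseteq> topspace X"
  shows "alt_closure X A B \<alpha> \<subseteq>
    X closure_of ((if even_ord \<alpha> then A else B) \<inter> alt_closure X A B \<alpha>)"
proof -
  define Z where "Z = (if even_ord \<alpha> then A else B) \<inter> {x. \<forall>\<beta>\<in>{..<\<alpha>}. x \<in> alt_closure X A B \<beta>}"
  have eq: "alt_closure X A B \<alpha> = X closure_of Z"
    unfolding Z_def by (rule alt_closure.simps)
  have "Z \<subseteq> topspace X" using assms by (auto simp: Z_def)
  then have "Z \<subseteq> X closure_of Z" by (rule closure_of_subset)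
  then have "Z \<subseteq> (if even_ord \<alpha> then A else B) \<inter> X closure_of Z"
    by (auto simp: Z_def)
  then show ?thesis unfolding eq by (rule closure_of_mono)
qed

text \<open>By Baire's theorem the intersection of all the dense open sets behind \<open>A\<close>
  and \<open>B\<close> is dense; here it is empty.\<close>

lemma disjoint_dense_gdelta:
  assumes X: "completely_metrizable_space X"
    and A: "gdelta_in X A" "X closure_of A = topspace X"
    and B: "gdelta_in X B" "X closure_of B = topspace X"
    and "A \<inter> B = {}"
  shows "topspace X = {}"
proof -
  obtain C D where C: "\<And>n::nat. openin X (C n)" "\<Inter> (range C) = A"
    and D: "\<And>n::nat. openin X (D n)" "\<Inter> (range D) = B"
    using A(1) B(1) unfolding gdelta_in_descending by metis
  have "X closure_of T = topspace X" if "S \<subseteq> T" "X closure_of S = topspace X" for S T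
    using closure_of_mono[OF that(1), of X] closure_of_subset_topspace[of X T] that(2) by blast
  then have "X closure_of C n = topspace X" "X closure_of D n = topspace X" for n
    using A(2) B(2) C(2) D(2) by (metis INF_lower UNIV_I)+
  then have "X closure_of (\<Inter> (range C \<union> range D)) = topspace X"
    using X C(1) D(1) by (intro Baire_category) auto
  moreover have "\<Inter> (range C \<union> range D) = {}"
    using C(2) D(2) assms(6) by blast
  ultimately show ?thesis by simp
qed

text \<open>Consecutive stages have opposite parities. If they are the same closed set
  \<open>K\<close>, then \<open>A\<close> and \<open>B\<close> both have dense trace on
  \<open>K\<close>, which is completely metrizable as a closed subspace.\<close>

lemma alt_closure_stable:
  assumes X: "completely_metrizable_space X"
    and A: "gdelta_in X A" and B: "gdelta_in X B" and "A \<inter> B = {}"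
    and eq: "alt_closure X A B \<alpha> = alt_closure X A B (osuc \<alpha>)"
  shows "alt_closure X A B \<alpha> = {}"
proof -
  define K where "K = alt_closure X A B \<alpha>"
  have K: "closedin X K" unfolding K_def by (rule closedin_alt_closure)
  note sub = gdelta_in_subset[OF A] gdelta_in_subset[OF B]
  have "K \<subseteq> X closure_of (A \<inter> K)" "K \<subseteq> X closure_of (B \<inter> K)"
    using alt_closure_dense[OF sub, of \<alpha>] alt_closure_dense[OF sub, of "osuc \<alpha>"]
    unfolding eq[symmetric] K_def even_ord_osuc by (auto split: if_splits)
  then have "subtopology X K closure_of (A \<inter> K) = topspace (subtopology X K)"
    "subtopology X K closure_of (B \<inter> K) = topspace (subtopology X K)"
    using closedin_subset[OF K] unfolding closure_of_subtopology
    by (auto simp: Int_commute Int_left_commute)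
  moreover have "gdelta_in (subtopology X K) (A \<inter> K)" "gdelta_in (subtopology X K) (B \<inter> K)"
    using A B unfolding gdelta_in_subtopology by blast+
  ultimately have "topspace (subtopology X K) = {}"
    using completely_metrizable_space_closedin[OF X K] \<open>A \<inter> B = {}\<close>
    by (intro disjoint_dense_gdelta[where A = "A \<inter> K" and B = "B \<inter> K"]) auto
  then show ?thesis
    using closedin_subset[OF K] by (simp add: K_def Int_absorb1)
qed

text \<open>Once the earlier stages are fixed, a stage is monotone in \<open>A\<close> or in
  \<open>B\<close>, according to parity. A larger function has a larger \<open>A\<close> and a
  smaller \<open>B\<close>; this matches the alternation in \<open>altlex_less\<close>.\<close>

lemma alt_closure_compare:
  assumes "A \<subseteq> A'" "B' \<subseteq> B"
    and "\<And>\<beta>. \<beta> < \<alpha> \<Longrightarrow> alt_closure X A B \<beta> = alt_closure X A' B' \<beta>"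
  shows "if even_ord \<alpha> then alt_closure X A B \<alpha> \<subseteq> alt_closure X A' B' \<alpha>
    else alt_closure X A' B' \<alpha> \<subseteq> alt_closure X A B \<alpha>"
proof -
  have "{x. \<forall>\<beta>\<in>{..<\<alpha>}. x \<in> alt_closure X A B \<beta>} = {x. \<forall>\<beta>\<in>{..<\<alpha>}. x \<in> alt_closure X A' B' \<beta>}"
    using assms(3) by auto
  then show ?thesis
    unfolding alt_closure.simps[of X A B \<alpha>] alt_closure.simps[of X A' B' \<alpha>]
    using assms(1,2) by (auto intro!: closure_of_mono)
qed

text \<open>The point survives even stages through \<open>A'\<close> and odd stages through
  \<open>B\<close>, since the stages of both pairs coincide.\<close>

lemma alt_closure_eq_imp_mem:
  assumes "A' \<subseteq> topspace X" "x \<in> A'" "x \<in> B"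
    and eq: "\<And>\<alpha>. alt_closure X A B \<alpha> = alt_closure X A' B' \<alpha>"
  shows "x \<in> alt_closure X A B \<alpha>"
proof (induction \<alpha> rule: less_induct)
  case (less \<alpha>)
  have mem: "x \<in> X closure_of Z" if "x \<in> Z" for Z
    using that assms(1,2) closure_of_subset_Int[of X Z] by blast
  show ?case
  proof (cases "even_ord \<alpha>")
    case True
    then have "x \<in> alt_closure X A' B' \<alpha>"
      unfolding alt_closure.simps[of X A' B' \<alpha>] using less assms(2) eq by (intro mem) auto
    then show ?thesis using eq by simp
  next
    case False
    then show ?thesis
      unfolding alt_closure.simps[of X A B \<alpha>] using less assms(3) by (intro mem) auto
  qed
qed

text \<open>A point of \<open>C\<close> outside \<open>D\<close> has a basic neighbourhood missing
  \<open>D\<close>. Hence closed sets can be compared by the indices of the basic sets that they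
  meet.\<close>

lemma closedin_detect:
  assumes U: "\<And>V x. openin X V \<Longrightarrow> x \<in> V \<Longrightarrow> \<exists>i. x \<in> U i \<and> U i \<subseteq> V"
    and "closedin X C" "closedin X D" "\<And>i. U i \<inter> C \<noteq> {} \<Longrightarrow> U i \<inter> D \<noteq> {}"
  shows "C \<subseteq> D"
proof
  fix x assume "x \<in> C"
  show "x \<in> D"
  proof (rule ccontr)
    assume "x \<notin> D"
    then have "openin X (topspace X - D)" "x \<in> topspace X - D"
      using \<open>x \<in> C\<close> closedin_subset[OF assms(2)] assms(3) by auto
    then obtain i where "x \<in> U i" "U i \<subseteq> topspace X - D"
      using U by blast
    then show False using assms(4)[of i] \<open>x \<in> C\<close> by blast
  qed
qed

section \<open>Baire class 1 functions\<close>

text \<open>The limit is below \<open>c\<close> iff the values eventually stay below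
  \<open>c\<close> by some margin \<open>inverse (Suc m)\<close>. The margin allows weak
  inequalities, which define closed sets and survive the limit.\<close>

lemma fsigma_limit_sublevel:
  assumes F: "\<And>n. continuous_map X euclideanreal (F n)"
    and lim: "\<And>x. x \<in> topspace X \<Longrightarrow> (\<lambda>n. F n x) \<longlonglongrightarrow> f x"
  shows "fsigma_in X {x \<in> topspace X. f x < c}"
proof -
  define K where "K m k = {x \<in> topspace X. \<forall>n\<ge>k. F n x \<le> c - inverse (Suc m)}" for m k :: nat
  have "K m k = topspace X \<inter> (\<Inter>n\<in>{k..}. {x \<in> topspace X. F n x \<in> {..c - inverse (Suc m)}})" for m k
    by (auto simp: K_def)
  moreover have "closedin X {x \<in> topspace X. F n x \<in> {..c - inverse (Suc m)}}" for n m
    using F by (rule closedin_continuous_map_preimage) simp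
  ultimately have K: "closedin X (K m k)" for m k
    by (auto intro!: closedin_Int closedin_Inter)
  have "{x \<in> topspace X. f x < c} = (\<Union>(m, k)\<in>UNIV. K m k)"
  proof (intro equalityI subsetI)
    fix x assume x: "x \<in> {x \<in> topspace X. f x < c}"
    then obtain m where m: "inverse (Suc m) < c - f x"
      using reals_Archimedean[of "c - f x"] by auto
    then have "\<forall>\<^sub>F n in sequentially. F n x < c - inverse (Suc m)"
      using x lim by (intro order_tendstoD(2)[of _ "f x"]) auto
    then obtain k where "\<forall>n\<ge>k. F n x < c - inverse (Suc m)"
      unfolding eventually_sequentially by blast
    then have "x \<in> K m k"
      using x by (auto simp: K_def intro: less_imp_le)
    then show "x \<in> (\<Union>(m, k)\<in>UNIV. K m k)" by blast
  next
    fix x assume "x \<in> (\<Union>(m, k)\<in>UNIV. K m k)"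
    then obtain m k where x: "x \<in> topspace X" "\<forall>n\<ge>k. F n x \<le> c - inverse (Suc m)"
      by (auto simp: K_def)
    then have "f x \<le> c - inverse (Suc m)"
      using lim by (intro LIMSEQ_le_const2[of "\<lambda>n. F n x"]) auto
    moreover have "inverse (real (Suc m)) > 0" by simp
    ultimately have "f x < c" by linarith
    then show "x \<in> {x \<in> topspace X. f x < c}" using x by simp
  qed
  moreover have "fsigma_in X (\<Union>((\<lambda>(m, k). K m k) ` UNIV))"
    using K by (intro fsigma_in_Union closed_imp_fsigma_in) auto
  ultimately show ?thesis by simp
qed

lemma baire_one_gdelta:
  assumes "f \<in> baire_one X"
  shows "gdelta_in X {x \<in> topspace X. c \<le> f x}" "gdelta_in X {x \<in> topspace X. f x \<le> c}"
proof -
  obtain F where F: "\<And>n::nat. continuous_map X euclideanreal (F n)"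
    "\<And>x. x \<in> topspace X \<Longrightarrow> (\<lambda>n. F n x) \<longlonglongrightarrow> f x"
    using assms unfolding baire_one_def by blast
  have "fsigma_in X {x \<in> topspace X. f x < c}"
    using F by (rule fsigma_limit_sublevel)
  moreover have "fsigma_in X {x \<in> topspace X. - f x < - c}"
    using F by (intro fsigma_limit_sublevel[where F = "\<lambda>n x. - F n x"] continuous_map_minus tendsto_minus)
  moreover have "topspace X - {x \<in> topspace X. c \<le> f x} = {x \<in> topspace X. f x < c}"
    "topspace X - {x \<in> topspace X. f x \<le> c} = {x \<in> topspace X. - f x < - c}"
    by auto
  ultimately show "gdelta_in X {x \<in> topspace X. c \<le> f x}" "gdelta_in X {x \<in> topspace X. f x \<le> c}"
    unfolding gdelta_in_fsigma_in by (metis (no_types, lifting) mem_Collect_eq subsetI)+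
qed

lemma rational_gaps:
  obtains p q :: "nat \<Rightarrow> real" where "\<And>j. p j < q j" "\<And>s t. s < t \<Longrightarrow> \<exists>j. s \<le> p j \<and> q j \<le> t"
proof -
  define S :: "(real \<times> real) set" where "S = {(a, b). a \<in> \<rat> \<and> b \<in> \<rat> \<and> a < b}"
  have "countable S"
    by (rule countable_subset[of _ "\<rat> \<times> \<rat>"]) (auto simp: S_def countable_rat)
  moreover have "(0, 1) \<in> S" by (simp add: S_def)
  then have "S \<noteq> {}" by blast
  ultimately have S: "range (from_nat_into S) = S" by (intro range_from_nat_into)
  have gap: "fst (from_nat_into S j) < snd (from_nat_into S j)" for j
    using S rangeI[of "from_nat_into S" j] by (auto simp: S_def)
  have "\<exists>j. s \<le> fst (from_nat_into S j) \<and> snd (from_nat_into S j) \<le> t" if "s < t" for s t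
  proof -
    obtain a where a: "a \<in> \<rat>" "s < a" "a < t" using Rats_dense_in_real[OF \<open>s < t\<close>] by blast
    obtain b where b: "b \<in> \<rat>" "a < b" "b < t" using Rats_dense_in_real[OF a(3)] by blast
    have "(a, b) \<in> range (from_nat_into S)" unfolding S using a b by (simp add: S_def)
    then obtain j where "from_nat_into S j = (a, b)" by (metis rangeE)
    then show ?thesis using a b by (intro exI[of _ j]) simp
  qed
  then show ?thesis using gap by (intro that[of "\<lambda>j. fst (from_nat_into S j)"]) auto
qed

lemma baire_one_embeds_decr_seqs:
  assumes "Polish_space X"
  shows "poset_embeds (baire_one X) (pointwise_less X) decr_seqs altlex_less"
proof -
  have cm: "completely_metrizable_space X" and "second_countable X"
    using assms unfolding Polish_space_def
    by (auto intro: separable_metrizable_imp_second_countable completely_metrizable_imp_metrizable_space)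
  then obtain U :: "nat \<Rightarrow> 'a set"
    where U: "\<And>V x. openin X V \<Longrightarrow> x \<in> V \<Longrightarrow> \<exists>i. x \<in> U i \<and> U i \<subseteq> V"
    using second_countable_sequence[OF \<open>second_countable X\<close>] by metis
  obtain p q :: "nat \<Rightarrow> real"
    where pq: "\<And>j. p j < q j" "\<And>s t. s < t \<Longrightarrow> \<exists>j. s \<le> p j \<and> q j \<le> t"
    using rational_gaps by metis
  define A where "A f j = {x \<in> topspace X. q j \<le> f x}" for f j
  define B where "B f j = {x \<in> topspace X. f x \<le> p j}" for f j
  define C where "C f j = alt_closure X (A f j) (B f j)" for f j
  \<comment> \<open>One set of naturals records the closed sets of all gaps \<open>j\<close> at
    once; by \<open>S_mono\<close> its inclusions are the simultaneous inclusions for all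
    \<open>j\<close>.\<close>
  define S where "S f \<alpha> = {prod_encode (i, j) |i j. U i \<inter> C f j \<alpha> \<noteq> {}}" for f \<alpha>
  have S_iff: "prod_encode (i, j) \<in> S f \<alpha> \<longleftrightarrow> U i \<inter> C f j \<alpha> \<noteq> {}" for i j f \<alpha>
    by (auto simp: S_def prod_encode_eq)
  have closed: "closedin X (C f j \<alpha>)" for f j \<alpha>
    unfolding C_def by (rule closedin_alt_closure)
  have S_mono: "S f \<alpha> \<subseteq> S g \<beta> \<longleftrightarrow> (\<forall>j. C f j \<alpha> \<subseteq> C g j \<beta>)" for f g \<alpha> \<beta>
  proof
    assume "S f \<alpha> \<subseteq> S g \<beta>"
    then show "\<forall>j. C f j \<alpha> \<subseteq> C g j \<beta>"
      using S_iff by (intro allI closedin_detect[OF U closed closed]) blast+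
  next
    assume "\<forall>j. C f j \<alpha> \<subseteq> C g j \<beta>"
    then show "S f \<alpha> \<subseteq> S g \<beta>"
      unfolding S_def by blast
  qed
  then have S_eq: "S f \<alpha> = S g \<beta> \<longleftrightarrow> (\<forall>j. C f j \<alpha> = C g j \<beta>)" for f g \<alpha> \<beta>
    by (metis order_antisym order_refl)
  have anti: "antimono (S f)" for f
    by (rule antimonoI) (simp add: S_mono C_def antimonoD[OF alt_closure_antimono])
  have stable: "C f j \<alpha> = {}" if "f \<in> baire_one X" "S f \<alpha> = S f (osuc \<alpha>)" for f j \<alpha>
    unfolding C_def
  proof (rule alt_closure_stable[OF cm])
    show "gdelta_in X (A f j)" "gdelta_in X (B f j)"
      unfolding A_def B_def using baire_one_gdelta[OF that(1)] by blast+
    show "A f j \<inter> B f j = {}"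
      using pq(1)[of j] by (auto simp: A_def B_def)
    show "alt_closure X (A f j) (B f j) \<alpha> = alt_closure X (A f j) (B f j) (osuc \<alpha>)"
      using that(2) unfolding S_eq C_def by blast
  qed
  have "decr_seq_of (S f) \<in> decr_seqs" if "f \<in> baire_one X" for f
  proof (rule decr_seq_of_in_decr_seqs[OF anti])
    show "S f \<alpha> = {}" if "S f \<alpha> = S f (osuc \<alpha>)" for \<alpha>
      using stable[OF \<open>f \<in> baire_one X\<close> that] by (simp add: S_def)
  qed
  moreover have "altlex_less (decr_seq_of (S f)) (decr_seq_of (S g))"
    if f: "f \<in> baire_one X" and less: "pointwise_less X f g" for f g
  proof -
    have AB: "A f j \<subseteq> A g j" "B g j \<subseteq> B f j" for j
      using less by (fastforce simp: A_def B_def pointwise_less_def)+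
    have "\<exists>\<alpha>. S f \<alpha> \<noteq> S g \<alpha>"
    proof (rule ccontr)
      assume "\<nexists>\<alpha>. S f \<alpha> \<noteq> S g \<alpha>"
      then have eq: "C f j \<alpha> = C g j \<alpha>" for j \<alpha>
        using S_eq by blast
      \<comment> \<open>A gap between \<open>f x\<close> and \<open>g x\<close> puts
        \<open>x\<close> into \<open>B f j\<close> and \<open>A g j\<close>, so \<open>x\<close>
        would lie in every stage, although a stable stage is empty.\<close>
      obtain x where x: "x \<in> topspace X" "f x < g x"
        using less unfolding pointwise_less_def by blast
      then obtain j where "f x \<le> p j" "q j \<le> g x"
        using pq(2) by blast
      then have "x \<in> C f j \<alpha>" for \<alpha>
        unfolding C_def using eq[unfolded C_def] x
        by (intro alt_closure_eq_imp_mem[where A' = "A g j" and B' = "B g j"]) (auto simp: A_def B_def)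
      moreover obtain \<alpha> where "S f \<alpha> = S f (osuc \<alpha>)"
        using antimono_stabilises[OF anti] by blast
      ultimately show False
        using stable[OF f] by blast
    qed
    then obtain \<delta> where \<delta>: "S f \<delta> \<noteq> S g \<delta>" "\<And>\<alpha>. \<alpha> < \<delta> \<Longrightarrow> S f \<alpha> = S g \<alpha>"
      unfolding exists_least_iff[of "\<lambda>\<alpha>. S f \<alpha> \<noteq> S g \<alpha>"] by blast
    \<comment> \<open>Before \<delta> the stages agree for every gap, so at \<delta> all gaps
      compare in the same direction, fixed by the parity of \<delta>.\<close>
    have "if even_ord \<delta> then C f j \<delta> \<subseteq> C g j \<delta> else C g j \<delta> \<subseteq> C f j \<delta>" for j
      unfolding C_def using \<delta>(2) AB
      by (intro alt_closure_compare) (auto simp: S_eq C_def)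
    then have "if even_ord \<delta> then S f \<delta> \<subset> S g \<delta> else S g \<delta> \<subset> S f \<delta>"
      using \<delta>(1) S_mono by (auto simp: psubset_eq split: if_splits)
    then show ?thesis
      by (intro altlex_less_decr_seq_of[where \<delta> = \<delta>] anti \<delta>(2))
  qed
  ultimately show ?thesis
    unfolding poset_embeds_def
    by (intro exI[of _ "\<lambda>f. decr_seq_of (S f)"]) (auto simp: monotone_on_def)
qed

section \<open>The equivalences from a cycle of three embeddings\<close>

theorem theorem3p13:
  fixes X :: "'a topology"
  assumes "Polish_space X" and "uncountable (topspace X)"
  shows "(\<forall>(L :: 'l set) R. strict_linear_ordering L R \<longrightarrow>
            (poset_embeds L R (baire_one X) (pointwise_less X) \<longleftrightarrow>
             poset_embeds L R decr_seqs altlex_less) \<and>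
            (poset_embeds L R decr_seqs altlex_less \<longleftrightarrow>
             poset_embeds L R (Delta02 X) (\<subset>))) \<and>
         poset_embeds decr_seqs altlex_less (Delta02 X) (\<subset>) \<and>
         poset_embeds (Delta02 X) (\<subset>) decr_seqs altlex_less \<and>
         poset_embeds decr_seqs altlex_less (baire_one X) (pointwise_less X) \<and>
         poset_embeds (baire_one X) (pointwise_less X) decr_seqs altlex_less \<and>
         poset_embeds (Delta02 X) (\<subset>) (baire_one X) (pointwise_less X) \<and>
         poset_embeds (baire_one X) (pointwise_less X) (Delta02 X) (\<subset>)"
proof -
  have "normal_space X"
    using assms(1) by (auto simp: Polish_space_def
        intro: metrizable_imp_normal_space completely_metrizable_imp_metrizable_space)
  then have DB: "poset_embeds (Delta02 X) (\<subset>) (baire_one X) (pointwise_less X)"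
    by (rule Delta02_embeds_baire_one)
  note SD = decr_seqs_embeds_Delta02[OF assms]
    and BS = baire_one_embeds_decr_seqs[OF assms(1)]
  note SB = poset_embeds_trans[OF SD DB]
    and DS = poset_embeds_trans[OF DB BS]
    and BD = poset_embeds_trans[OF BS SD]
  have "poset_embeds L R (baire_one X) (pointwise_less X) \<longleftrightarrow> poset_embeds L R decr_seqs altlex_less"
    "poset_embeds L R decr_seqs altlex_less \<longleftrightarrow> poset_embeds L R (Delta02 X) (\<subset>)"
    for L :: "'l set" and R
    using SD DS SB BS by (blast intro: poset_embeds_trans)+
  then show ?thesis
    using SD DS SB BS DB BD by simp
qed

end
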